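(* Let $\mathbf{R}=\langle R,+,\cdot,0,1,\alpha\rangle$ be an orthomodular near semiring. Define $x\vee y=x+y$, $x'=\alpha(x)$ and $x\wedge y=(x'\vee y')'$ for $x,y\in R$. Then $\mathbf{L}(\mathbf{R})=\langle R,\vee,\wedge,{}',0,1\rangle$ is an orthomodular lattice.
   Context: A near semiring is an algebra $\langle R,+,\cdot,0,1\rangle$ such that: (i) $\langle R,+,0\rangle$ is a commutative monoid; (ii) $x\cdot 1=x=1\cdot x$ (multiplication need not be associative or commutative); (iii) $(x+y)\cdot z=(x\cdot z)+(y\cdot z)$; (iv) $x\cdot 0=0\cdot x=0$. It is idempotent if $x+x=x$; then $x\le y$ iff $x+y=y$ defines a partial order, called the induced order. An involutive near semiring is an idempotent near semiring with a map $\alpha:R\to R$ such that $\alpha(\alpha(x))=x$, and $x\le y$ implies $\alpha(y)\le\alpha(x)$. A Łukasiewicz near semiring is an involutive near semiring satisfying the identity $\alpha(x\cdot\alpha(y))\cdot\alpha(y)=\alpha(y\cdot\alpha(x))\cdot\alpha(x)$. An orthomodular near semiring is a Łukasiewicz near semiring satisfying the identity $x=x\cdot(x+y)$. An orthomodular lattice is an algebra $\langle L,\vee,\wedge,{}',0,1\rangle$ such that $\langle L,\vee,\wedge,0,1\rangle$ is a bounded lattice, $x\wedge x'=0$, $x\vee x'=1$, $x''=x$, $x\le y$ implies $y'\le x'$, and $x\le y$ implies $y=x\vee(y\wedge x')$. *)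

theory Defs
  imports "HOL-Library.Complemented_Lattices"
begin

text \<open>Multiplication is neither assumed associative nor commutative, and only right
  distributivity is required.\<close>

locale near_semiring = add: comm_monoid plus zero
  for plus :: "'a \<Rightarrow> 'a \<Rightarrow> 'a"  (infixl \<open>\<oplus>\<close> 65)
    and times :: "'a \<Rightarrow> 'a \<Rightarrow> 'a"  (infixl \<open>\<otimes>\<close> 70)
    and zero :: 'a  (\<open>\<zero>\<close>)
    and one :: 'a  (\<open>\<one>\<close>) +
  assumes mult_one_right: "x \<otimes> \<one> = x"
    and mult_one_left: "\<one> \<otimes> x = x"
    and distrib_right: "(x \<oplus> y) \<otimes> z = (x \<otimes> z) \<oplus> (y \<otimes> z)"
    and mult_zero_right: "x \<otimes> \<zero> = \<zero>"
    and mult_zero_left: "\<zero> \<otimes> x = \<zero>"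

locale idempotent_near_semiring = near_semiring +
  assumes add_idem: "x \<oplus> x = x"
begin

definition induced_le :: "'a \<Rightarrow> 'a \<Rightarrow> bool"  (infix \<open>\<preceq>\<close> 50)
  where "x \<preceq> y \<longleftrightarrow> x \<oplus> y = y"

end

locale involutive_near_semiring = idempotent_near_semiring +
  fixes \<alpha> :: "'a \<Rightarrow> 'a"
  assumes involution: "\<alpha> (\<alpha> x) = x"
    and antitone: "x \<preceq> y \<Longrightarrow> \<alpha> y \<preceq> \<alpha> x"

locale lukasiewicz_near_semiring = involutive_near_semiring +
  assumes lukasiewicz: "\<alpha> (x \<otimes> \<alpha> y) \<otimes> \<alpha> y = \<alpha> (y \<otimes> \<alpha> x) \<otimes> \<alpha> x"

locale orthomodular_near_semiring = lukasiewicz_near_semiring +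
  assumes orthomodular: "x = x \<otimes> (x \<oplus> y)"

text \<open>The library's class predicate takes the order relations and the difference as parameters
  besides \<open>\<squnion>\<close>, \<open>\<sqinter>\<close>, complement, bottom and top. For an algebra in the latter signature only,
  the order is the lattice order given by \<open>x \<squnion> y = y\<close>, and the difference is the one forced by
  the class axiom \<open>x - y = x \<sqinter> - y\<close>.\<close>

definition orthomodular_lattice_algebra ::
    "('a \<Rightarrow> 'a \<Rightarrow> 'a) \<Rightarrow> ('a \<Rightarrow> 'a \<Rightarrow> 'a) \<Rightarrow> ('a \<Rightarrow> 'a) \<Rightarrow> 'a \<Rightarrow> 'a \<Rightarrow> bool"
  where "orthomodular_lattice_algebra join meet compl zero one \<longleftrightarrow>
    class.orthomodular_lattice
      (\<lambda>x y. meet x (compl y)) compl meet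
      (\<lambda>x y. join x y = y) (\<lambda>x y. join x y = y \<and> x \<noteq> y)
      join zero one"

end

theory Submission
  imports Defs
begin

text \<open>The law \<open>x = x \<otimes> (x \<oplus> y)\<close> makes \<open>\<one>\<close> the top element and gives \<open>x = x \<otimes> y\<close> whenever
  \<open>x \<preceq> y\<close>; the Lukasiewicz identity at \<open>y = \<one>\<close> gives \<open>x \<otimes> \<alpha> x = \<zero>\<close>. A common lower bound \<open>z\<close>
  of \<open>x\<close> and \<open>\<alpha> x\<close> then satisfies \<open>z = z \<otimes> \<alpha> x \<preceq> x \<otimes> \<alpha> x = \<zero>\<close>, so \<open>\<alpha>\<close> is an
  orthocomplementation. For \<open>x \<preceq> y\<close> the product \<open>y \<otimes> \<alpha> x\<close> lies below both \<open>y\<close> and \<open>\<alpha> x\<close>, and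
  the Lukasiewicz identity recovers \<open>y\<close> from it; hence \<open>y = x\<close> as soon as \<open>y\<close> and \<open>\<alpha> x\<close> have
  only \<open>\<zero>\<close> as a common lower bound, which is equivalent to the orthomodular law.\<close>

context idempotent_near_semiring
begin

lemma induced_le_refl: "x \<preceq> x"
  by (simp add: induced_le_def add_idem)

lemma induced_le_antisym: "x \<preceq> y \<Longrightarrow> y \<preceq> x \<Longrightarrow> x = y"
  by (metis induced_le_def add.commute)

lemma induced_le_trans: "x \<preceq> y \<Longrightarrow> y \<preceq> z \<Longrightarrow> x \<preceq> z"
  by (metis induced_le_def add.assoc)

lemma zero_le: "\<zero> \<preceq> x"
  by (simp add: induced_le_def)

lemma le_plus_left: "x \<preceq> x \<oplus> y"
  by (metis induced_le_def add.assoc add_idem)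

lemma le_plus_right: "y \<preceq> x \<oplus> y"
  by (metis le_plus_left add.commute)

lemma plus_least: "x \<preceq> z \<Longrightarrow> y \<preceq> z \<Longrightarrow> x \<oplus> y \<preceq> z"
  by (simp add: induced_le_def add.assoc)

lemma mult_mono_left: "x \<preceq> y \<Longrightarrow> x \<otimes> z \<preceq> y \<otimes> z"
  by (metis induced_le_def distrib_right)

end

context involutive_near_semiring
begin

lemma le_compl_swap: "x \<preceq> \<alpha> y \<Longrightarrow> y \<preceq> \<alpha> x"
  by (metis antitone involution)

lemma compl_le_swap: "\<alpha> x \<preceq> y \<Longrightarrow> \<alpha> y \<preceq> x"
  by (metis antitone involution)

lemma meet_le_left: "\<alpha> (\<alpha> x \<oplus> \<alpha> y) \<preceq> x"
  by (rule compl_le_swap[OF le_plus_left])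

lemma meet_le_right: "\<alpha> (\<alpha> x \<oplus> \<alpha> y) \<preceq> y"
  by (rule compl_le_swap[OF le_plus_right])

lemma meet_greatest: "z \<preceq> x \<Longrightarrow> z \<preceq> y \<Longrightarrow> z \<preceq> \<alpha> (\<alpha> x \<oplus> \<alpha> y)"
  by (rule le_compl_swap[OF plus_least[OF antitone antitone]])

end

context orthomodular_near_semiring
begin

lemma le_one: "x \<preceq> \<one>"
  using orthomodular[of \<one> x] by (simp add: induced_le_def mult_one_left add.commute)

lemma compl_zero: "\<alpha> \<zero> = \<one>"
  by (rule induced_le_antisym[OF le_one le_compl_swap[OF zero_le]])

lemma compl_one: "\<alpha> \<one> = \<zero>"
  by (metis compl_zero involution)

lemma mult_eq_left_if_le: "x \<preceq> y \<Longrightarrow> x \<otimes> y = x"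
  using orthomodular[of x y] by (simp add: induced_le_def)

text \<open>Right distributivity gives monotonicity in the left factor, so \<open>x\<close> may be
  raised to \<open>\<one>\<close>. The bound by the left factor is harder; see
  \<open>mult_compl_le_left\<close>.\<close>

lemma mult_le_right: "x \<otimes> y \<preceq> y"
  by (metis mult_mono_left le_one mult_one_left)

lemma mult_compl: "x \<otimes> \<alpha> x = \<zero>"
  using lukasiewicz[of x \<one>]
  by (simp add: compl_one mult_zero_right mult_one_left involution)

lemma le_zero_if_le_compl:
  assumes "z \<preceq> x" "z \<preceq> \<alpha> x"
  shows "z = \<zero>"
proof -
  have "z \<preceq> x \<otimes> \<alpha> x"
    using mult_mono_left[OF assms(1), of "\<alpha> x"] mult_eq_left_if_le[OF assms(2)] by simp
  then show ?thesis
    by (simp add: mult_compl induced_le_antisym zero_le)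
qed

lemma plus_compl: "x \<oplus> \<alpha> x = \<one>"
proof -
  \<comment> \<open>By antitonicity this complement lies below both \<open>x\<close> and
    \<open>\<alpha> x\<close>.\<close>
  have "\<alpha> (x \<oplus> \<alpha> x) = \<zero>"
    by (rule le_zero_if_le_compl[OF compl_le_swap[OF le_plus_right] antitone[OF le_plus_left]])
  then show ?thesis
    by (metis compl_zero involution)
qed

text \<open>Monotonicity puts \<open>x \<otimes> \<alpha> y\<close> below
  \<open>y \<otimes> \<alpha> y = \<zero>\<close>, so the other side of the Lukasiewicz identity
  collapses to \<open>\<one> \<otimes> \<alpha> y\<close>.\<close>

lemma mult_compl_recover:
  assumes "x \<preceq> y"
  shows "\<alpha> (y \<otimes> \<alpha> x) \<otimes> \<alpha> x = \<alpha> y"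
proof -
  have "x \<otimes> \<alpha> y = \<zero>"
    using mult_mono_left[OF assms, of "\<alpha> y"]
    by (simp add: mult_compl induced_le_antisym zero_le)
  then show ?thesis
    using lukasiewicz[of x y] by (simp add: compl_zero mult_one_left)
qed

text \<open>Here the Lukasiewicz identity yields that \<open>\<alpha> x\<close> and \<open>\<alpha> (y \<otimes> \<alpha> x)\<close> commute.\<close>

lemma mult_compl_le_left:
  assumes "x \<preceq> y"
  shows "y \<otimes> \<alpha> x \<preceq> y"
proof -
  define z where "z = y \<otimes> \<alpha> x"
  have "z \<preceq> \<alpha> x"
    by (simp add: z_def mult_le_right)
  then have "x \<otimes> \<alpha> z = x" "z \<otimes> \<alpha> x = z"
    by (simp_all add: mult_eq_left_if_le le_compl_swap)
  then have "\<alpha> x \<otimes> \<alpha> z = \<alpha> z \<otimes> \<alpha> x"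
    using lukasiewicz[of x z] by simp
  also have "\<dots> = \<alpha> y"
    using mult_compl_recover[OF assms] by (simp add: z_def)
  \<comment> \<open>Commuting the factors has made \<open>\<alpha> z\<close> the right factor, which
    bounds the product.\<close>
  finally have "\<alpha> y \<preceq> \<alpha> z"
    by (metis mult_le_right)
  then show ?thesis
    unfolding z_def by (metis antitone involution)
qed

lemma eq_if_le_if_disjoint_compl:
  assumes "x \<preceq> y" and disjoint: "\<And>z. z \<preceq> y \<Longrightarrow> z \<preceq> \<alpha> x \<Longrightarrow> z = \<zero>"
  shows "x = y"
proof -
  have "y \<otimes> \<alpha> x = \<zero>"
    by (intro disjoint mult_compl_le_left mult_le_right assms(1))
  then have "\<alpha> x = \<alpha> y"
    using mult_compl_recover[OF assms(1)] by (simp add: compl_zero mult_one_left)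
  then show ?thesis
    by (metis involution)
qed

lemma orthomodular_law:
  assumes "x \<preceq> y"
  shows "x \<oplus> \<alpha> (\<alpha> (\<alpha> x) \<oplus> \<alpha> y) = y"
proof -
  let ?m = "\<alpha> (\<alpha> (\<alpha> x) \<oplus> \<alpha> y)"
  show "x \<oplus> ?m = y"
  \<comment> \<open>A common lower bound of \<open>y\<close> and
    \<open>\<alpha> (x \<oplus> ?m)\<close> lies below \<open>\<alpha> x\<close>, hence below both
    \<open>?m\<close> and \<open>\<alpha> ?m\<close>.\<close>
  proof (rule eq_if_le_if_disjoint_compl)
    show "x \<oplus> ?m \<preceq> y"
      by (rule plus_least[OF assms meet_le_right])
  next
    fix z
    assume "z \<preceq> y" and z: "z \<preceq> \<alpha> (x \<oplus> ?m)"
    have "z \<preceq> \<alpha> x"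
      by (rule induced_le_trans[OF z antitone[OF le_plus_left]])
    then have "z \<preceq> ?m"
      using \<open>z \<preceq> y\<close> by (rule meet_greatest)
    moreover have "z \<preceq> \<alpha> ?m"
      by (rule induced_le_trans[OF z antitone[OF le_plus_right]])
    ultimately show "z = \<zero>"
      by (rule le_zero_if_le_compl)
  qed
qed

end

theorem theorem10:
  fixes plus times join meet :: "'a \<Rightarrow> 'a \<Rightarrow> 'a"
    and zero one :: 'a
    and \<alpha> compl :: "'a \<Rightarrow> 'a"
  assumes "orthomodular_near_semiring plus times zero one \<alpha>"
    and join: "\<And>x y. join x y = plus x y"
    and compl: "\<And>x. compl x = \<alpha> x"
    and meet: "\<And>x y. meet x y = compl (join (compl x) (compl y))"
  shows "orthomodular_lattice_algebra join meet compl zero one"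
proof -
  interpret orthomodular_near_semiring plus times zero one \<alpha> by fact
  have ops: "join = plus" "compl = \<alpha>" "meet = (\<lambda>x y. \<alpha> (plus (\<alpha> x) (\<alpha> y)))"
    by (simp_all add: fun_eq_iff join compl meet)
  show ?thesis
    unfolding orthomodular_lattice_algebra_def ops induced_le_def[symmetric]
  proof (unfold_locales, goal_cases)
    case (1 x y)
    show ?case using induced_le_antisym[of x y] by (cases "x = y") (simp_all add: induced_le_refl, blast)
  next
    case 2
    show ?case by (rule induced_le_refl)
  next
    case 3
    then show ?case by (rule induced_le_trans)
  next
    case 4
    then show ?case by (rule induced_le_antisym)
  next
    case 5
    show ?case by (rule meet_le_left)
  next
    case 6
    show ?case by (rule meet_le_right)
  next
    case 7
    then show ?case by (rule meet_greatest)
  next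
    case 8
    show ?case by (rule le_plus_left)
  next
    case 9
    show ?case by (rule le_plus_right)
  next
    case 10
    then show ?case by (rule plus_least)
  next
    case 11
    show ?case by (rule zero_le)
  next
    case 12
    show ?case by (rule le_one)
  next
    case 13
    \<comment> \<open>The meet of \<open>x\<close> and \<open>\<alpha> x\<close> unfolds to the
      complement of \<open>\<alpha> x \<oplus> \<alpha> (\<alpha> x)\<close>, so
      \<open>plus_compl\<close> applies at \<open>\<alpha> x\<close>.\<close>
    show ?case by (simp only: plus_compl compl_one)
  next
    case 14
    show ?case by (rule plus_compl)
  next
    case 15
    show ?case by (rule refl)
  next
    case 16
    show ?case by (rule involution)
  next
    case 17
    then show ?case by (rule antitone)
  next
    case 18
    then show ?case by (rule orthomodular_law)
  qed
qed

end
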